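(* Let $q$ be a prime power and let $P_q(B,C),P'_q(B,C)\in\mathbb F_q[B,C]$ be two optimal determining polynomials for primitive quadratic polynomials over $\mathbb F_q$. Then $$P_q(B,C)\equiv P'_q(B,C)\pmod{\Phi_{q-1}(C)}.$$ Equivalently, they have the same image in the quotient ring $A[B]=\mathbb F_q[B,C]/(\Phi_{q-1}(C))$, where $A=\mathbb F_q[C]/(\Phi_{q-1}(C))$. Consequently, the optimal determining polynomial determines a unique regular function on the affine scheme $\mathcal X=\mathbb A^1_{\mathbb F_q}\times\operatorname{Spec}A=\operatorname{Spec}A[B]$.
   Context: $\Phi_{q-1}(C)\in\mathbb F_q[C]$ is the $(q-1)$-st cyclotomic polynomial in the indeterminate $C$. A primitive element of $\mathbb F_q$ is a generator of $\mathbb F_q^*$. A monic quadratic polynomial over $\mathbb F_q$ is primitive if it is the minimal polynomial over $\mathbb F_q$ of a generator of $\mathbb F_{q^2}^*$. A polynomial $P(B,C)\in\mathbb F_q[B,C]$ is an optimal determining polynomial for primitive quadratic polynomials over $\mathbb F_q$ if for every primitive element $c$ of $\mathbb F_q$, $$P(B,c)=\prod_{b\in\mathcal P_c}(B-b),\qquad \mathcal P_c=\{b\in\mathbb F_q: X^2+bX+c\text{ is primitive over }\mathbb F_q\}.$$ *)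

theory Defs
  imports
    "HOL-Algebra.Algebraic_Closure_Type"
    "HOL-Algebra.UnivPoly"
    "HOL-Library.Cardinality"
    Complex_Main
begin

text \<open>
  A finite type \<open>'a\<close> of class \<open>field\<close> plays the role of the field with \<open>q = CARD('a)\<close> elements.
  An element of the bivariate ring in the indeterminates \<open>B\<close> and \<open>C\<close> has type \<open>'a poly poly\<close>:
  the outer variable is \<open>B\<close>, and the coefficients are polynomials in \<open>C\<close>.
\<close>

section \<open>Cyclotomic polynomials\<close>

text \<open>
  The \<open>n\<close>-th cyclotomic polynomial lies in \<open>int poly\<close> although its defining product is taken over
  the primitive complex roots of unity; it is read in any ring via the canonical map from the
  integers. It is only meaningful for \<open>n > 0\<close>.
\<close>

definition primitive_unity_roots :: "nat \<Rightarrow> complex set" where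
  "primitive_unity_roots n = {z. z ^ n = 1 \<and> (\<forall>k. 0 < k \<and> k < n \<longrightarrow> z ^ k \<noteq> 1)}"

definition cyclotomic_int :: "nat \<Rightarrow> int poly" where
  "cyclotomic_int n =
     (THE f. map_poly of_int f = (\<Prod>z\<in>primitive_unity_roots n. [:- z, 1:]))"

definition cyclotomic :: "nat \<Rightarrow> 'a::comm_ring_1 poly" where
  "cyclotomic n = map_poly of_int (cyclotomic_int n)"

section \<open>Primitive elements and primitive quadratic polynomials\<close>

text \<open>\<open>x\<close> generates the multiplicative group of the subfield \<open>K\<close>. (As \<open>0 powi 0 = 1\<close> and
  \<open>0 powi k = 0\<close> otherwise, the equation forces \<open>x \<noteq> 0\<close>.)\<close>

definition generates_units :: "'b::field set \<Rightarrow> 'b \<Rightarrow> bool" where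
  "generates_units K x \<longleftrightarrow> range (\<lambda>k::int. x powi k) = K - {0}"

definition primitive_element :: "'a::{finite,field} \<Rightarrow> bool" where
  "primitive_element c \<longleftrightarrow> generates_units UNIV c"

text \<open>The field with \<open>q\<^sup>2\<close> elements: the unique subfield of that order in the algebraic closure.\<close>

definition quadratic_ext :: "'a::{finite,field} alg_closure set" where
  "quadratic_ext = {x. x ^ (CARD('a) ^ 2) = x}"

definition is_minimal_poly :: "'a::field poly \<Rightarrow> 'a alg_closure \<Rightarrow> bool" where
  "is_minimal_poly f x \<longleftrightarrow>
     Polynomial.lead_coeff f = 1 \<and> poly (map_poly to_ac f) x = 0 \<and>
     (\<forall>g. g \<noteq> 0 \<and> poly (map_poly to_ac g) x = 0 \<longrightarrow> Polynomial.degree f \<le> Polynomial.degree g)"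

definition primitive_quadratic :: "'a::{finite,field} poly \<Rightarrow> bool" where
  "primitive_quadratic f \<longleftrightarrow>
     Polynomial.degree f = 2 \<and> Polynomial.lead_coeff f = 1 \<and>
     (\<exists>x. generates_units quadratic_ext x \<and> is_minimal_poly f x)"

section \<open>Optimal determining polynomials\<close>

definition specialize_C :: "'a::{finite,field} \<Rightarrow> 'a poly poly \<Rightarrow> 'a poly" where
  "specialize_C c P = map_poly (\<lambda>f. poly f c) P"

definition primitive_coeffs :: "'a::{finite,field} \<Rightarrow> 'a set" where
  "primitive_coeffs c = {b. primitive_quadratic [:c, b, 1:]}"

definition optimal_determining :: "'a::{finite,field} poly poly \<Rightarrow> bool" where
  "optimal_determining P \<longleftrightarrow>
     (\<forall>c. primitive_element c \<longrightarrow>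
        specialize_C c P = (\<Prod>b\<in>primitive_coeffs c. [:- b, 1:]))"

section \<open>The quotient rings\<close>

definition Phi :: "'a::{finite,field} poly" where
  "Phi = cyclotomic (CARD('a) - 1)"

definition Phi_ideal :: "'a::{finite,field} poly set" where
  "Phi_ideal = PIdl\<^bsub>ring_of_type_algebra\<^esub> Phi"

definition ring_A :: "'a::{finite,field} poly set ring" where
  "ring_A = ring_of_type_algebra Quot Phi_ideal"

definition ring_AB :: "('a::{finite,field} poly set, nat \<Rightarrow> 'a poly set) up_ring" where
  "ring_AB = UP ring_A"

text \<open>Reducing the coefficients modulo the cyclotomic polynomial maps the bivariate ring onto
  \<open>ring_AB\<close>.\<close>

definition image_AB :: "'a::{finite,field} poly poly \<Rightarrow> (nat \<Rightarrow> 'a poly set)" where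
  "image_AB P = (\<lambda>n. Phi_ideal +>\<^bsub>ring_of_type_algebra\<^esub> Polynomial.coeff P n)"

text \<open>The presentation as a quotient of the bivariate ring; there, the cyclotomic polynomial
  in \<open>C\<close> is the constant \<open>[:Phi:]\<close>.\<close>

definition Phi_ideal_BC :: "'a::{finite,field} poly poly set" where
  "Phi_ideal_BC = PIdl\<^bsub>ring_of_type_algebra\<^esub> [:Phi:]"

definition ring_BC :: "'a::{finite,field} poly poly set ring" where
  "ring_BC = ring_of_type_algebra Quot Phi_ideal_BC"

definition image_BC :: "'a::{finite,field} poly poly \<Rightarrow> 'a poly poly set" where
  "image_BC P = Phi_ideal_BC +>\<^bsub>ring_of_type_algebra\<^esub> P"

section \<open>Regular functions on affine schemes\<close>

text \<open>
  The global sections of the structure sheaf of the spectrum of a commutative ring, as in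
  Hartshorne, II.2: families of elements of the local rings that are locally fractions.
\<close>

definition prime_spectrum :: "('r, 'm) ring_scheme \<Rightarrow> 'r set set" where
  "prime_spectrum R = {p. primeideal p R}"

definition zariski_open :: "('r, 'm) ring_scheme \<Rightarrow> 'r set set \<Rightarrow> bool" where
  "zariski_open R U \<longleftrightarrow> (\<exists>I. ideal I R \<and> U = {p \<in> prime_spectrum R. \<not> I \<subseteq> p})"

text \<open>The fraction \<open>a / s\<close> in the localization at \<open>p\<close>, as the class of all pairs \<open>(b, t)\<close> with
  \<open>u t a = u s b\<close> for some \<open>u\<close> outside \<open>p\<close>.\<close>

definition loc_frac :: "('r, 'm) ring_scheme \<Rightarrow> 'r set \<Rightarrow> 'r \<Rightarrow> 'r \<Rightarrow> ('r \<times> 'r) set" where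
  "loc_frac R p a s =
     {(b, t). b \<in> carrier R \<and> t \<in> carrier R - p \<and>
        (\<exists>u\<in>carrier R - p. u \<otimes>\<^bsub>R\<^esub> (t \<otimes>\<^bsub>R\<^esub> a) = u \<otimes>\<^bsub>R\<^esub> (s \<otimes>\<^bsub>R\<^esub> b))}"

definition localization :: "('r, 'm) ring_scheme \<Rightarrow> 'r set \<Rightarrow> ('r \<times> 'r) set set" where
  "localization R p = {loc_frac R p a s | a s. a \<in> carrier R \<and> s \<in> carrier R - p}"

definition regular_functions :: "('r, 'm) ring_scheme \<Rightarrow> ('r set \<Rightarrow> ('r \<times> 'r) set) set" where
  "regular_functions R =
     {\<sigma> \<in> \<Pi>\<^sub>E p\<in>prime_spectrum R. localization R p.
        \<forall>p\<in>prime_spectrum R. \<exists>U. zariski_open R U \<and> p \<in> U \<and>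
          (\<exists>a\<in>carrier R. \<exists>s\<in>carrier R. \<forall>p'\<in>U. s \<notin> p' \<and> \<sigma> p' = loc_frac R p' a s)}"

text \<open>The regular function given by a ring element.\<close>

definition regular_function_of :: "('r, 'm) ring_scheme \<Rightarrow> 'r \<Rightarrow> 'r set \<Rightarrow> ('r \<times> 'r) set" where
  "regular_function_of R a = (\<lambda>p\<in>prime_spectrum R. loc_frac R p a \<one>\<^bsub>R\<^esub>)"

end

theory Submission
  imports Defs
begin

text \<open>
  Write \<open>n = q - 1\<close>. Over the field with \<open>q\<close> elements, \<open>X\<^sup>n - 1\<close> is the product of the distinct
  linear factors \<open>X - a\<close> with \<open>a \<noteq> 0\<close>, and also the product of the cyclotomic polynomials of order
  dividing \<open>n\<close>. Hence a nonzero root \<open>a\<close> of the \<open>n\<close>-th cyclotomic polynomial has order \<open>n\<close>: if its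
  order were a proper divisor \<open>d\<close>, then \<open>X - a\<close> would divide both \<open>X\<^sup>d - 1\<close> and the cyclotomic
  polynomial, so its square would divide \<open>X\<^sup>n - 1\<close>. Therefore the cyclotomic polynomial divides
  every polynomial in \<open>C\<close> that vanishes at all primitive elements, in particular every
  \<open>B\<close>-coefficient of the difference of two optimal determining polynomials.
\<close>

section \<open>Split monic polynomials\<close>

text \<open>Induction on \<open>S\<close>: the product over the earlier elements is nonzero at the
  new root \<open>x\<close>, so in a domain the cofactor must vanish at \<open>x\<close> and yields
  the next linear factor.\<close>

lemma prod_linear_dvd:
  fixes f :: "'a::idom poly"
  assumes "finite S" and "\<And>a. a \<in> S \<Longrightarrow> poly f a = 0"
  shows "(\<Prod>a\<in>S. [:- a, 1:]) dvd f"
  using assms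
proof (induction S rule: finite_induct)
  case empty
  then show ?case by simp
next
  case (insert x S)
  then obtain g where g: "f = (\<Prod>a\<in>S. [:- a, 1:]) * g"
    by (auto simp: dvd_def)
  have "poly (\<Prod>a\<in>S. [:- a, 1:]) x \<noteq> 0"
    using insert by (auto simp: poly_prod)
  with g insert.prems[of x] have "poly g x = 0" by simp
  then obtain h where "g = [:- x, 1:] * h" by (auto simp: poly_eq_0_iff_dvd dvd_def)
  then have "f = (\<Prod>a\<in>insert x S. [:- a, 1:]) * h"
    unfolding g by (simp only: prod.insert[OF insert.hyps] mult_ac)
  then show ?case by (rule dvdI)
qed

lemma degree_prod_linear:
  "Polynomial.degree (\<Prod>a\<in>S. [:- a, 1:] :: 'a::idom poly) = card S"
  by (subst degree_prod_sum_eq) auto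

text \<open>Comparing degrees and leading coefficients makes the cofactor of the product equal to 1.
  It serves to split X^n - 1 over the complex numbers as well as X^(q-1) - 1 over the finite
  field.\<close>

lemma monic_eq_prod_linear:
  fixes f :: "'a::idom poly"
  assumes "finite S" and root: "\<And>a. a \<in> S \<Longrightarrow> poly f a = 0"
    and monic: "Polynomial.lead_coeff f = 1" and deg: "Polynomial.degree f = card S"
  shows "f = (\<Prod>a\<in>S. [:- a, 1:])"
proof -
  obtain g where g: "f = (\<Prod>a\<in>S. [:- a, 1:]) * g"
    using prod_linear_dvd[of S f] assms by (auto simp: dvd_def)
  have "g \<noteq> 0" using g monic by auto
  then have "Polynomial.degree f = card S + Polynomial.degree g"
    unfolding g by (subst degree_mult_eq) (auto simp: degree_prod_linear assms(1))
  then have "Polynomial.degree g = 0" using deg by simp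
  moreover have "Polynomial.lead_coeff g = 1"
    using monic unfolding g by (simp add: lead_coeff_mult lead_coeff_prod)
  ultimately show ?thesis
    using g by (metis degree_0_id mult.right_neutral of_nat_1 one_pCons pCons_0_0 degree_eq_zeroE coeff_pCons_0)
qed

text \<open>Linear factors are removed one at a time. If \<open>g * k\<close> contains the factor X
  - x and \<open>g\<close> does not vanish at \<open>x\<close>, then \<open>k\<close> does, so X - x
  can be taken out of \<open>k\<close> and cancelled.\<close>

lemma dvd_cancel_linear_prod:
  fixes g :: "'a::idom poly"
  assumes "finite S" and "\<And>a. a \<in> S \<Longrightarrow> poly g a \<noteq> 0"
    and "g dvd f * (\<Prod>a\<in>S. [:- a, 1:])"
  shows "g dvd f"
  using assms
proof (induction S rule: finite_induct)
  case empty
  then show ?case by simp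
next
  case (insert x S)
  let ?h = "f * (\<Prod>a\<in>S. [:- a, 1:])"
  have "f * (\<Prod>a\<in>insert x S. [:- a, 1:]) = [:- x, 1:] * ?h"
    by (simp only: prod.insert[OF insert.hyps] mult_ac)
  then obtain k where k: "[:- x, 1:] * ?h = g * k"
    using insert.prems(2) by (metis dvdE)
  have "poly ([:- x, 1:] * ?h) x = 0" by (simp only: poly_mult) simp
  then have "poly g x * poly k x = 0" by (simp only: k poly_mult)
  then have "poly k x = 0" using insert.prems(1)[of x] by simp
  then obtain k' where k': "k = [:- x, 1:] * k'" by (auto simp: poly_eq_0_iff_dvd dvd_def)
  have "[:- x, 1:] * ?h = [:- x, 1:] * (g * k')"
    using k unfolding k' by (simp only: mult_ac)
  then have "?h = g * k'" by (subst (asm) mult_cancel_left) auto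
  then have "g dvd ?h" by simp
  then show ?case using insert.IH insert.prems(1) by auto
qed

lemma degree_monom_minus_1:
  "n > 0 \<Longrightarrow> Polynomial.degree (Polynomial.monom 1 n - 1 :: 'a::comm_ring_1 poly) = n"
  using degree_add_eq_left[of "-1" "Polynomial.monom (1::'a) n"]
  by (simp add: degree_monom_eq)

lemma lead_coeff_monom_minus_1:
  "n > 0 \<Longrightarrow> Polynomial.lead_coeff (Polynomial.monom 1 n - 1 :: 'a::comm_ring_1 poly) = 1"
  by (simp add: degree_monom_minus_1)

section \<open>Integer polynomials read in other rings\<close>

lemma map_poly_of_int_mult:
  "map_poly of_int (p * q) = (map_poly of_int p * map_poly of_int q :: 'a::comm_ring_1 poly)"
  by (rule poly_eqI) (simp add: coeff_map_poly coeff_mult)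

lemma map_poly_of_int_diff:
  "map_poly of_int (p - q) = (map_poly of_int p - map_poly of_int q :: 'a::comm_ring_1 poly)"
  by (rule poly_eqI) (simp add: coeff_map_poly)

lemma map_poly_of_int_monom:
  "map_poly of_int (Polynomial.monom 1 n) = (Polynomial.monom 1 n :: 'a::comm_ring_1 poly)"
  by (rule poly_eqI) (simp add: coeff_map_poly)

lemma map_poly_of_int_prod:
  "map_poly of_int (\<Prod>i\<in>A. f i) = (\<Prod>i\<in>A. map_poly of_int (f i) :: 'a::comm_ring_1 poly)"
  by (induction A rule: infinite_finite_induct) (auto simp: map_poly_of_int_mult)

lemma map_poly_of_int_eq_iff:
  "(map_poly of_int p :: 'a::{comm_ring_1,ring_char_0} poly) = map_poly of_int q \<longleftrightarrow> p = q"
  by (auto simp: poly_eq_iff coeff_map_poly)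

section \<open>The cyclotomic factorization\<close>

text \<open>Division with remainder by the least positive exponent \<open>d\<close>: the power at
  \<open>n mod d\<close> is again 1, so minimality forces the remainder to be 0. Stated in a monoid
  because it is applied both to complex roots of unity and to field elements.\<close>

lemma minimal_exponent_dvd:
  fixes z :: "'a::monoid_mult"
  assumes "n > 0" and "z ^ n = 1"
  obtains d where "d > 0" "d dvd n" "z ^ d = 1" "\<And>k. 0 < k \<Longrightarrow> k < d \<Longrightarrow> z ^ k \<noteq> 1"
proof -
  define d where "d = (LEAST d. d > 0 \<and> z ^ d = 1)"
  have d: "d > 0 \<and> z ^ d = 1"
    unfolding d_def by (rule LeastI[of _ n]) (use assms in auto)
  have min: "z ^ k \<noteq> 1" if "0 < k" "k < d" for k
    using not_less_Least[of k "\<lambda>d. d > 0 \<and> z ^ d = 1"] that unfolding d_def by blast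
  have "z ^ n = z ^ (d * (n div d) + n mod d)" by simp
  also have "\<dots> = z ^ (n mod d)" using d by (simp only: power_add power_mult) simp
  finally have "z ^ (n mod d) = 1" using assms by simp
  then have "n mod d = 0" using min[of "n mod d"] d by auto
  then show thesis using that d min by auto
qed

text \<open>The roots of X^n - 1 are partitioned by their exact order, which is a divisor of
  \<open>n\<close>.\<close>

lemma prod_primitive_unity_roots:
  assumes "n > 0"
  shows "(\<Prod>d | d dvd n. \<Prod>z\<in>primitive_unity_roots d. [:- z, 1:]) = Polynomial.monom 1 n - 1"
proof -
  have fin: "finite {z::complex. z ^ n = 1}"
    using assms by (simp add: finite_roots_unity)
  have sub: "primitive_unity_roots d \<subseteq> {z. z ^ n = 1}" if "d dvd n" for d
    using that by (auto simp: primitive_unity_roots_def dvd_def power_mult)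
  have union: "{z::complex. z ^ n = 1} = (\<Union>d\<in>{d. d dvd n}. primitive_unity_roots d)"
    (is "?L = ?R")
  proof
    show "?L \<subseteq> ?R"
    proof
      fix z :: complex
      assume "z \<in> ?L"
      then obtain d where "d > 0" "d dvd n" "z ^ d = 1" "\<And>k. 0 < k \<Longrightarrow> k < d \<Longrightarrow> z ^ k \<noteq> 1"
        using minimal_exponent_dvd[of n z] assms by auto
      then show "z \<in> ?R" by (auto simp: primitive_unity_roots_def)
    qed
  qed (use sub in auto)
  \<comment> \<open>Positivity of the divisors matters here: for order 0 the defining condition
    would hold for every complex number.\<close>
  have disjoint: "primitive_unity_roots d \<inter> primitive_unity_roots e = {}"
    if "d dvd n" "e dvd n" "d \<noteq> e" for d e
    using that assms dvd_pos_nat[of n]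
    unfolding primitive_unity_roots_def by (auto, metis linorder_neqE_nat)
  have "Polynomial.monom 1 n - 1 = (\<Prod>z | z ^ n = 1. [:- z, 1::complex:])"
    by (rule monic_eq_prod_linear)
      (use assms fin in \<open>auto simp: degree_monom_minus_1 lead_coeff_monom_minus_1 card_roots_unity_eq poly_monom\<close>)
  also have "\<dots> = (\<Prod>d | d dvd n. \<Prod>z\<in>primitive_unity_roots d. [:- z, 1:])"
    unfolding union
    by (rule prod.UNION_disjoint) (use assms disjoint finite_subset[OF sub fin] in auto)
  finally show ?thesis by simp
qed

section \<open>Integrality of the cyclotomic polynomials\<close>

lemma lead_coeff_of_int_poly_eq_1:
  assumes "(map_poly of_int f :: complex poly) = (\<Prod>z\<in>S. [:- z, 1:])"
  shows "Polynomial.lead_coeff f = 1"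
proof -
  have "Polynomial.degree (map_poly of_int f :: complex poly) = Polynomial.degree f"
    by (rule degree_map_poly) auto
  then have "of_int (Polynomial.lead_coeff f) = Polynomial.lead_coeff (map_poly of_int f :: complex poly)"
    by (simp add: coeff_map_poly)
  also have "\<dots> = 1" unfolding assms by (simp add: lead_coeff_prod)
  finally show ?thesis by simp
qed

text \<open>Divide with remainder over the integers. Over the larger domain the remainder becomes a
  multiple of \<open>g\<close>; if it were nonzero, its degree would be at least that of
  \<open>g\<close>. Hence the integral quotient already maps to \<open>h\<close>.\<close>

lemma quotient_of_int_polys_monic:
  fixes f g :: "int poly" and h :: "'a::{idom,ring_char_0} poly"
  assumes monic: "Polynomial.lead_coeff g = 1"
    and eq: "map_poly of_int f = map_poly of_int g * h"
  shows "\<exists>q. map_poly of_int q = h"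
proof -
  obtain q r where qr: "pseudo_divmod f g = (q, r)" by force
  have "g \<noteq> 0" using monic by auto
  note * = pseudo_divmod[OF this qr]
  \<comment> \<open>Pseudo-division scales \<open>f\<close> by a power of the leading coefficient of
    \<open>g\<close>; as this is 1, it is genuine division with remainder.\<close>
  from *(1) have fqr: "f = g * q + r" using monic by simp
  let ?m = "map_poly of_int :: int poly \<Rightarrow> 'a poly"
  have deg: "Polynomial.degree (?m p) = Polynomial.degree p" for p
    by (rule degree_map_poly) auto
  have "r = f - g * q" using fqr by simp
  then have r: "?m r = ?m g * (h - ?m q)"
    by (simp only: map_poly_of_int_diff map_poly_of_int_mult eq right_diff_distrib)
  have "h - ?m q = 0"
  proof (rule ccontr)
    assume nz: "h - ?m q \<noteq> 0"
    have "?m g \<noteq> 0" using \<open>g \<noteq> 0\<close> map_poly_of_int_eq_iff[of g 0] by auto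
    then have "Polynomial.degree (?m r) = Polynomial.degree g + Polynomial.degree (h - ?m q)"
      using nz unfolding r by (simp add: degree_mult_eq deg)
    moreover have "r \<noteq> 0" using r nz \<open>?m g \<noteq> 0\<close> by auto
    ultimately show False using *(2) deg[of r] by auto
  qed
  then show ?thesis by auto
qed

text \<open>Strong induction: X^n - 1 is the wanted product times those for the proper divisors of
  \<open>n\<close>. The latter come from monic integer polynomials, so the quotient is integral
  too.\<close>

lemma cyclotomic_int_exists:
  assumes "n > 0"
  shows "\<exists>f. map_poly of_int f = (\<Prod>z\<in>primitive_unity_roots n. [:- z, 1:])"
  using assms
proof (induction n rule: less_induct)
  case (less n)
  let ?c = "\<lambda>d. \<Prod>z\<in>primitive_unity_roots d. [:- z, 1:]"
  let ?D = "{d. d dvd n} - {n}"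
  have "\<exists>f. map_poly of_int f = ?c d" if "d \<in> ?D" for d
    using that less.IH[of d] less.prems dvd_imp_le[of d n] dvd_pos_nat[of n d] by fastforce
  then obtain F where F: "\<And>d. d \<in> ?D \<Longrightarrow> map_poly of_int (F d) = ?c d"
    by metis
  have "Polynomial.lead_coeff (\<Prod>d\<in>?D. F d) = 1"
    unfolding lead_coeff_prod using F lead_coeff_of_int_poly_eq_1 by (intro prod.neutral) blast
  moreover have "map_poly of_int (Polynomial.monom 1 n - 1) = map_poly of_int (\<Prod>d\<in>?D. F d) * ?c n"
  proof -
    have "map_poly of_int (\<Prod>d\<in>?D. F d) * ?c n = (\<Prod>d\<in>?D. ?c d) * ?c n"
      by (simp add: map_poly_of_int_prod F)
    also have "\<dots> = (\<Prod>d | d dvd n. ?c d)"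
      using less.prems by (subst prod.remove[of _ n]) (auto simp: mult_ac)
    finally show ?thesis
      using less.prems
      by (simp add: prod_primitive_unity_roots map_poly_of_int_diff map_poly_of_int_monom)
  qed
  ultimately show ?case by (rule quotient_of_int_polys_monic)
qed

text \<open>The description in \<open>cyclotomic_int\<close> is proper: a preimage exists, and it is
  unique because the integers embed into the complex numbers.\<close>

lemma map_poly_cyclotomic_int:
  assumes "n > 0"
  shows "map_poly of_int (cyclotomic_int n) = (\<Prod>z\<in>primitive_unity_roots n. [:- z, 1:])"
proof -
  have "\<exists>!f. map_poly of_int f = (\<Prod>z\<in>primitive_unity_roots n. [:- z, 1:])"
    using cyclotomic_int_exists[OF assms] by (metis map_poly_of_int_eq_iff)
  then show ?thesis unfolding cyclotomic_int_def by (rule theI')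
qed

text \<open>The complex factorization descends to integer polynomials by injectivity, and from there
  maps to every commutative ring, in particular to positive characteristic.\<close>

lemma prod_cyclotomic:
  assumes "n > 0"
  shows "(\<Prod>d | d dvd n. cyclotomic d) = (Polynomial.monom 1 n - 1 :: 'a::comm_ring_1 poly)"
proof -
  have "map_poly of_int (\<Prod>d | d dvd n. cyclotomic_int d)
      = (\<Prod>d | d dvd n. \<Prod>z\<in>primitive_unity_roots d. [:- z, 1:])"
    using assms by (auto simp: map_poly_of_int_prod map_poly_cyclotomic_int dvd_pos_nat intro!: prod.cong)
  also have "\<dots> = map_poly of_int (Polynomial.monom 1 n - 1)"
    using assms by (simp add: prod_primitive_unity_roots map_poly_of_int_diff map_poly_of_int_monom)
  finally have "(\<Prod>d | d dvd n. cyclotomic_int d) = Polynomial.monom 1 n - 1"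
    by (simp only: map_poly_of_int_eq_iff)
  then show ?thesis
    unfolding cyclotomic_def
    by (simp flip: map_poly_of_int_prod)
      (simp add: map_poly_of_int_diff map_poly_of_int_monom)
qed

text \<open>The factors of X^d - 1 are indexed by divisors of \<open>d\<close>, all different from
  \<open>n\<close>, so \<open>cyclotomic n\<close> is a further factor of X^n - 1. This is the
  source of the double root below.\<close>

lemma cyclotomic_mult_dvd:
  assumes "n > 0" "d dvd n" "d \<noteq> n"
  shows "(Polynomial.monom 1 d - 1) * cyclotomic n dvd (Polynomial.monom 1 n - 1 :: 'a::comm_ring_1 poly)"
proof -
  have "d > 0" using assms dvd_pos_nat by blast
  have "{e. e dvd d} \<subseteq> {e. e dvd n} - {n}"
    using assms \<open>d > 0\<close> by (auto intro: dvd_trans dest: dvd_antisym)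
  then have "(\<Prod>e | e dvd d. cyclotomic e) dvd (\<Prod>e\<in>{e. e dvd n} - {n}. cyclotomic e :: 'a poly)"
    using assms by (intro prod_dvd_prod_subset) auto
  then have "(Polynomial.monom 1 d - 1) * cyclotomic n dvd
      (\<Prod>e\<in>{e. e dvd n} - {n}. cyclotomic e) * (cyclotomic n :: 'a poly)"
    using prod_cyclotomic[OF \<open>d > 0\<close>, where 'a = 'a] by (simp add: mult_dvd_mono)
  also have "\<dots> = (\<Prod>e | e dvd n. cyclotomic e)"
    using assms by (subst prod.remove[of _ n]) (auto simp: mult_ac)
  finally show ?thesis using prod_cyclotomic[OF assms(1), where 'a = 'a] by simp
qed

section \<open>Cyclotomic polynomials over finite fields\<close>

text \<open>Multiplication by \<open>a\<close> permutes the nonzero elements, so their product is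
  unchanged when scaled by \<open>a ^ (q - 1)\<close>; cancel it.\<close>

lemma power_card_minus_1:
  fixes a :: "'a::{finite,field}"
  assumes "a \<noteq> 0"
  shows "a ^ (CARD('a) - 1) = 1"
proof -
  have "bij_betw ((*) a) (UNIV - {0}) (UNIV - {0})"
    by (rule bij_betwI[where g = "\<lambda>x. x / a"]) (use assms in auto)
  then have "(\<Prod>x\<in>UNIV - {0}. a * x) = (\<Prod>x\<in>UNIV - {0::'a}. x)"
    using prod.reindex_bij_betw[of "(*) a" "UNIV - {0}" "UNIV - {0}" "\<lambda>x. x"] by simp
  then have "a ^ card (UNIV - {0::'a}) * (\<Prod>x\<in>UNIV - {0}. x) = (\<Prod>x\<in>UNIV - {0::'a}. x)"
    by (simp add: prod.distrib)
  moreover have "(\<Prod>x\<in>UNIV - {0::'a}. x) \<noteq> 0" by simp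
  ultimately show ?thesis by (simp add: card_Diff_subset)
qed

lemma card_minus_1_pos: "CARD('a::{finite,field}) - 1 > 0"
proof -
  have "card {0, 1::'a} \<le> CARD('a)" by (rule card_mono) auto
  then show ?thesis by simp
qed

lemma monom_card_minus_1:
  "Polynomial.monom 1 (CARD('a) - 1) - 1 = (\<Prod>a\<in>UNIV - {0::'a::{finite,field}}. [:- a, 1:])"
  by (rule monic_eq_prod_linear)
    (use card_minus_1_pos[where 'a = 'a] in
      \<open>auto simp: lead_coeff_monom_minus_1 degree_monom_minus_1 power_card_minus_1 card_Diff_subset poly_monom
        simp del: One_nat_def\<close>)

text \<open>The powers with exponents 0, ..., q - 2 are pairwise distinct, hence by counting they
  exhaust the nonzero elements.\<close>

lemma primitive_elementI:
  fixes a :: "'a::{finite,field}"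
  assumes "a \<noteq> 0" and no: "\<And>k. 0 < k \<Longrightarrow> k < CARD('a) - 1 \<Longrightarrow> a ^ k \<noteq> 1"
  shows "primitive_element a"
proof -
  have inj: "inj_on (\<lambda>k. a ^ k) {..<CARD('a) - 1}"
  proof (rule linorder_inj_onI')
    fix i j
    assume ij: "i \<in> {..<CARD('a) - 1}" "j \<in> {..<CARD('a) - 1}" "i < j"
    have "a ^ j = a ^ i * a ^ (j - i)"
      using ij by (simp flip: power_add)
    moreover have "a ^ (j - i) \<noteq> 1" using ij by (intro no) auto
    ultimately show "a ^ i \<noteq> a ^ j" using assms(1) by auto
  qed
  have "(\<lambda>k. a ^ k) ` {..<CARD('a) - 1} = UNIV - {0}"
    by (rule card_subset_eq) (use assms(1) in \<open>auto simp: card_image[OF inj] card_Diff_subset simp del: One_nat_def\<close>)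
  moreover have "(\<lambda>k. a ^ k) ` {..<CARD('a) - 1} \<subseteq> range (\<lambda>k::int. a powi k)"
    by (auto intro!: image_eqI[of _ _ "int _"] simp: power_int_of_nat)
  moreover have "range (\<lambda>k::int. a powi k) \<subseteq> UNIV - {0}"
    using assms(1) by auto
  ultimately show ?thesis by (auto simp: primitive_element_def generates_units_def)
qed

lemma primitive_element_of_root_Phi:
  fixes a :: "'a::{finite,field}"
  assumes root: "poly Phi a = 0" and "a \<noteq> 0"
  shows "primitive_element a"
proof (rule primitive_elementI[OF \<open>a \<noteq> 0\<close>])
  let ?n = "CARD('a) - 1"
  fix k
  assume k: "0 < k" "k < ?n"
  show "a ^ k \<noteq> 1"
  proof
    assume "a ^ k = 1"
    then obtain m where m: "m > 0" "m dvd k" "a ^ m = 1" "\<And>k. 0 < k \<Longrightarrow> k < m \<Longrightarrow> a ^ k \<noteq> 1"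
      using minimal_exponent_dvd[of k a] k(1) by auto
    obtain d where d: "d > 0" "d dvd ?n" "a ^ d = 1" "\<And>k. 0 < k \<Longrightarrow> k < d \<Longrightarrow> a ^ k \<noteq> 1"
      using minimal_exponent_dvd[of ?n a] card_minus_1_pos power_card_minus_1[OF \<open>a \<noteq> 0\<close>] by auto
    \<comment> \<open>The exponent \<open>k\<close> need not divide q - 1. Both \<open>m\<close> and
      \<open>d\<close> are the order of \<open>a\<close>, so this order divides q - 1 and is also at
      most \<open>k\<close>.\<close>
    have "d = m" using m d by (metis linorder_neqE_nat)
    then have "d \<noteq> ?n" using m(2) k by (auto dest: dvd_imp_le)
    then have "(Polynomial.monom 1 d - 1) * Phi dvd (Polynomial.monom 1 ?n - 1 :: 'a poly)"
      unfolding Phi_def using d card_minus_1_pos by (intro cyclotomic_mult_dvd) auto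
    moreover have "[:- a, 1:] * [:- a, 1:] dvd (Polynomial.monom 1 d - 1) * Phi"
      using root d(3) by (intro mult_dvd_mono) (auto simp: poly_monom simp flip: poly_eq_0_iff_dvd)
    ultimately have "[:- a, 1:] * [:- a, 1:] dvd (\<Prod>a\<in>UNIV - {0::'a}. [:- a, 1:])"
      unfolding monom_card_minus_1 by (rule dvd_trans[rotated])
    also have "UNIV - {0} = insert a (UNIV - {0, a})"
      using \<open>a \<noteq> 0\<close> by blast
    also have "(\<Prod>b\<in>insert a (UNIV - {0, a}). [:- b, 1:]) = [:- a, 1:] * (\<Prod>b\<in>UNIV - {0, a}. [:- b, 1:])"
      by (rule prod.insert) auto
    \<comment> \<open>One copy of X - a cancels; the remaining product runs over the other nonzero
      elements and does not vanish at \<open>a\<close>.\<close>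
    finally have "[:- a, 1:] dvd (\<Prod>b\<in>UNIV - {0, a}. [:- b, 1:])"
      by (subst (asm) dvd_mult_cancel_left) auto
    then show False by (auto simp: poly_prod simp flip: poly_eq_0_iff_dvd)
  qed
qed

text \<open>Multiplied by X - a for every nonzero non-primitive \<open>a\<close>, \<open>f\<close>
  vanishes at all nonzero elements and so is a multiple of X^(q-1) - 1, hence of \<open>Phi\<close>.
  The added factors cancel because \<open>Phi\<close> has no root among these
  \<open>a\<close>.\<close>

lemma Phi_dvdI:
  fixes f :: "'a::{finite,field} poly"
  assumes "\<And>c. primitive_element c \<Longrightarrow> poly f c = 0"
  shows "Phi dvd f"
proof (rule dvd_cancel_linear_prod)
  let ?S = "{a::'a. a \<noteq> 0 \<and> \<not> primitive_element a}"
  let ?n = "CARD('a) - 1"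
  show "finite ?S" by simp
  show "poly Phi a \<noteq> 0" if "a \<in> ?S" for a
    using that primitive_element_of_root_Phi by auto
  have "Phi dvd (Polynomial.monom 1 ?n - 1 :: 'a poly)"
    unfolding Phi_def prod_cyclotomic[OF card_minus_1_pos, symmetric]
    using card_minus_1_pos[where 'a = 'a] by (intro dvd_prodI) auto
  also have "\<dots> dvd f * (\<Prod>a\<in>?S. [:- a, 1:])"
    unfolding monom_card_minus_1
    by (rule prod_linear_dvd) (auto simp: poly_prod assms)
  finally show "Phi dvd f * (\<Prod>a\<in>?S. [:- a, 1:])" .
qed

lemma Phi_dvd_diff_of_optimal_determining:
  fixes P P' :: "'a::{finite,field} poly poly"
  assumes "optimal_determining P" and "optimal_determining P'"
  shows "[:Phi:] dvd (P - P')"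
  \<comment> \<open>Divisibility by a constant in the outer variable is tested on each
    \<open>B\<close>-coefficient, a polynomial in \<open>C\<close>.\<close>
  unfolding const_poly_dvd_iff
proof (intro allI Phi_dvdI)
  fix n and c :: 'a
  assume "primitive_element c"
  then have "specialize_C c P = specialize_C c P'"
    using assms by (simp add: optimal_determining_def)
  then have "Polynomial.coeff (specialize_C c P) n = Polynomial.coeff (specialize_C c P') n"
    by simp
  then show "poly (Polynomial.coeff (P - P') n) c = 0"
    by (simp add: specialize_C_def coeff_map_poly)
qed

section \<open>The quotient rings\<close>

lemma ring_of_type_algebra_simps [simp]:
  "carrier (ring_of_type_algebra :: 'a::ring_1 ring) = UNIV"
  "x \<otimes>\<^bsub>ring_of_type_algebra\<^esub> y = (x * y :: 'a)"
  "x \<oplus>\<^bsub>ring_of_type_algebra\<^esub> y = (x + y :: 'a)"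
  "\<one>\<^bsub>ring_of_type_algebra\<^esub> = (1 :: 'a)"
  "\<zero>\<^bsub>ring_of_type_algebra\<^esub> = (0 :: 'a)"
  by (auto simp: ring_of_type_algebra_def)

lemma cgenideal_ring_of_type_algebra:
  "PIdl\<^bsub>ring_of_type_algebra\<^esub> (f :: 'a::comm_ring_1) = {g. f dvd g}"
  by (auto simp: cgenideal_def dvd_def mult.commute)

text \<open>The coset of \<open>x\<close> is the set of all \<open>g\<close> with
  \<open>f dvd g - x\<close>. This links quotients to divisibility, both in the polynomials in
  \<open>C\<close> and in the bivariate ring.\<close>

lemma coset_cgenideal_eq_iff:
  fixes f :: "'a::comm_ring_1"
  shows "PIdl\<^bsub>ring_of_type_algebra\<^esub> f +>\<^bsub>ring_of_type_algebra\<^esub> a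
      = PIdl\<^bsub>ring_of_type_algebra\<^esub> f +>\<^bsub>ring_of_type_algebra\<^esub> b \<longleftrightarrow> f dvd a - b"
    (is "?L = ?R \<longleftrightarrow> _")
proof -
  have coset: "PIdl\<^bsub>ring_of_type_algebra\<^esub> f +>\<^bsub>ring_of_type_algebra\<^esub> x = {g. f dvd g - x}" for x
  proof -
    have "g \<in> (\<Union>h\<in>{g. f dvd g}. {h + x})" if "f dvd g - x" for g
      using that by (intro UN_I[of "g - x"]) auto
    then show ?thesis
      unfolding cgenideal_ring_of_type_algebra a_r_coset_def' by auto
  qed
  show ?thesis unfolding coset
  proof
    assume eq: "{g. f dvd g - a} = {g. f dvd g - b}"
    have "a \<in> {g. f dvd g - a}" by simp
    then show "f dvd a - b" unfolding eq by simp
  next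
    assume *: "f dvd a - b"
    have "f dvd g - a \<longleftrightarrow> f dvd g - b" for g
      using dvd_add_left_iff[OF *, of "g - a"] by simp
    then show "{g. f dvd g - a} = {g. f dvd g - b}" by (rule Collect_cong)
  qed
qed

lemma ideal_cgenideal_ring_of_type_algebra:
  "ideal (PIdl\<^bsub>ring_of_type_algebra\<^esub> (f :: 'a::comm_ring_1)) ring_of_type_algebra"
  by (rule cring.cgenideal_ideal[OF cring_from_type_algebra]) simp

section \<open>The rings A and A[B] and reduction of coefficients\<close>

lemma ideal_Phi: "ideal (Phi_ideal :: 'a::{finite,field} poly set) ring_of_type_algebra"
  unfolding Phi_ideal_def by (rule ideal_cgenideal_ring_of_type_algebra)

lemma cring_ring_A: "cring (ring_A :: 'a::{finite,field} poly set ring)"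
  unfolding ring_A_def by (rule ideal.quotient_is_cring[OF ideal_Phi cring_from_type_algebra])

lemma cring_ring_AB: "cring (ring_AB :: ('a::{finite,field} poly set, nat \<Rightarrow> 'a poly set) up_ring)"
  unfolding ring_AB_def
  by (intro UP_cring.UP_cring UP_cring.intro cring_ring_A)

text \<open>The quotient map onto A, named so that \<open>image_AB\<close> can be handled as its
  coefficientwise extension.\<close>

definition proj_A :: "'a::{finite,field} poly \<Rightarrow> 'a poly set" where
  "proj_A f = Phi_ideal +>\<^bsub>ring_of_type_algebra\<^esub> f"

lemma proj_A_eq_iff: "proj_A f = proj_A g \<longleftrightarrow> Phi dvd f - g"
  unfolding proj_A_def Phi_ideal_def by (rule coset_cgenideal_eq_iff)

lemma proj_A_hom: "proj_A \<in> ring_hom ring_of_type_algebra ring_A"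
  using ideal.rcos_ring_hom[OF ideal_Phi] unfolding proj_A_def[abs_def] ring_A_def by simp

lemma proj_A_simps:
  "proj_A f \<in> carrier ring_A"
  "proj_A (f * g) = proj_A f \<otimes>\<^bsub>ring_A\<^esub> proj_A g"
  "proj_A (f + g) = proj_A f \<oplus>\<^bsub>ring_A\<^esub> proj_A g"
  "proj_A 1 = \<one>\<^bsub>ring_A\<^esub>"
  using ring_hom_closed[OF proj_A_hom, of f] ring_hom_mult[OF proj_A_hom, of f g]
    ring_hom_add[OF proj_A_hom, of f g] ring_hom_one[OF proj_A_hom] by auto

lemma proj_A_0: "proj_A 0 = \<zero>\<^bsub>ring_A\<^esub>"
  using ring_hom_zero[OF proj_A_hom] cring_ring_A ring_from_type_algebra
  by (auto simp: cring_def)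

lemma proj_A_sum: "finite S \<Longrightarrow> proj_A (\<Sum>i\<in>S. f i) = (\<Oplus>\<^bsub>ring_A\<^esub>i\<in>S. proj_A (f i))"
proof (induction S rule: finite_induct)
  case empty
  interpret cring ring_A by (rule cring_ring_A)
  show ?case by (simp add: proj_A_0)
next
  case (insert x S)
  interpret cring ring_A by (rule cring_ring_A)
  show ?case using insert by (simp add: proj_A_simps)
qed

lemma image_AB_eq: "image_AB P = (\<lambda>n. proj_A (Polynomial.coeff P n))"
  by (simp add: image_AB_def proj_A_def)

lemma image_AB_in_up: "image_AB P \<in> up ring_A"
proof (rule mem_upI)
  show "\<exists>n. bound \<zero>\<^bsub>ring_A\<^esub> n (image_AB P)"
    by (rule exI[of _ "Polynomial.degree P"])
      (auto simp: bound_def image_AB_eq coeff_eq_0 proj_A_0)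
qed (simp add: image_AB_eq proj_A_simps)

lemma image_AB_hom:
  "ring_hom_ring ring_of_type_algebra (ring_AB :: ('a::{finite,field} poly set, _) up_ring) image_AB"
proof (rule ring_hom_ringI2)
  show "image_AB \<in> ring_hom ring_of_type_algebra (ring_AB :: ('a poly set, _) up_ring)"
  proof (rule ring_hom_memI)
    fix P Q :: "'a poly poly"
    show "image_AB P \<in> carrier ring_AB"
      using image_AB_in_up by (simp add: ring_AB_def UP_def)
    show "image_AB (P \<otimes>\<^bsub>ring_of_type_algebra\<^esub> Q) = image_AB P \<otimes>\<^bsub>ring_AB\<^esub> image_AB Q"
      using image_AB_in_up[of P] image_AB_in_up[of Q]
      \<comment> \<open>Both products are the same convolution of coefficients, and
        \<open>proj_A\<close> commutes with finite sums.\<close>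
      by (simp add: ring_AB_def UP_def) (simp add: image_AB_eq coeff_mult proj_A_sum proj_A_simps)
    show "image_AB (P \<oplus>\<^bsub>ring_of_type_algebra\<^esub> Q) = image_AB P \<oplus>\<^bsub>ring_AB\<^esub> image_AB Q"
      using image_AB_in_up[of P] image_AB_in_up[of Q]
      by (simp add: ring_AB_def UP_def) (simp add: image_AB_eq proj_A_simps)
  next
    show "image_AB \<one>\<^bsub>ring_of_type_algebra\<^esub> = \<one>\<^bsub>ring_AB :: ('a poly set, _) up_ring\<^esub>"
      by (auto simp: ring_AB_def UP_def image_AB_eq proj_A_simps proj_A_0 fun_eq_iff)
  qed
qed (use cring_ring_AB ring_from_type_algebra in \<open>auto simp: cring_def\<close>)

lemma image_AB_surj:
  "range image_AB = carrier (ring_AB :: ('a::{finite,field} poly set, _) up_ring)"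
proof
  show "range image_AB \<subseteq> carrier (ring_AB :: ('a poly set, _) up_ring)"
    using image_AB_in_up by (auto simp: ring_AB_def UP_def)
next
  show "carrier (ring_AB :: ('a poly set, _) up_ring) \<subseteq> range image_AB"
  proof
    fix p :: "nat \<Rightarrow> 'a poly set"
    assume "p \<in> carrier ring_AB"
    then have p: "p \<in> up ring_A" by (simp add: ring_AB_def UP_def)
    then obtain N where N: "bound \<zero>\<^bsub>ring_A\<^esub> N p" by (auto simp: up_def)
    have "\<exists>f. p n = proj_A f" for n
      using mem_upD[OF p, of n] unfolding ring_A_def FactRing_def A_RCOSETS_def'
      by (auto simp: proj_A_def)
    then obtain r where r: "\<And>n. p n = proj_A (r n)" by metis
    \<comment> \<open>The sum is cut off at \<open>N\<close> because the chosen lifts of the zero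
      coefficients beyond \<open>N\<close> need not be zero.\<close>
    define Q where "Q = (\<Sum>i\<le>N. Polynomial.monom (r i) i)"
    have "Polynomial.coeff Q n = (if n \<le> N then r n else 0)" for n
      unfolding Q_def by (simp add: coeff_sum)
    then have "p = image_AB Q"
      using N r by (auto simp: image_AB_eq fun_eq_iff proj_A_0 bound_def not_le)
    then show "p \<in> range image_AB" by simp
  qed
qed

section \<open>Comparison of the two presentations of the quotient\<close>

lemma image_AB_eq_iff: "image_AB P = image_AB Q \<longleftrightarrow> [:Phi:] dvd P - Q"
  by (simp add: image_AB_eq fun_eq_iff proj_A_eq_iff const_poly_dvd_iff)

lemma image_BC_eq_iff: "image_BC P = image_BC Q \<longleftrightarrow> [:Phi:] dvd P - Q"
  unfolding image_BC_def Phi_ideal_BC_def by (rule coset_cgenideal_eq_iff)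

lemma kernel_image_AB:
  "a_kernel ring_of_type_algebra ring_AB image_AB = (Phi_ideal_BC :: 'a::{finite,field} poly poly set)"
proof -
  interpret ring_hom_ring ring_of_type_algebra "ring_AB :: ('a poly set, _) up_ring" image_AB
    by (rule image_AB_hom)
  have "image_AB 0 = \<zero>\<^bsub>ring_AB :: ('a poly set, _) up_ring\<^esub>"
    using hom_zero by simp
  then have "image_AB P = \<zero>\<^bsub>ring_AB\<^esub> \<longleftrightarrow> [:Phi:] dvd P" for P :: "'a poly poly"
    using image_AB_eq_iff[of P 0] by simp
  then show ?thesis
    unfolding a_kernel_def' Phi_ideal_BC_def cgenideal_ring_of_type_algebra
      ring_of_type_algebra_simps by blast
qed

text \<open>First isomorphism theorem for the surjection \<open>image_AB\<close>, whose kernel is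
  \<open>Phi_ideal_BC\<close>. The isomorphism sends a coset to the single value that
  \<open>image_AB\<close> takes on it.\<close>

lemma ring_BC_iso_ring_AB:
  "\<exists>h \<in> ring_iso (ring_BC :: 'a::{finite,field} poly poly set ring) ring_AB.
      \<forall>Q. h (image_BC Q) = image_AB Q"
proof -
  let ?h = "\<lambda>K. the_elem ((image_AB :: 'a poly poly \<Rightarrow> _) ` K)"
  have "?h \<in> ring_iso ring_BC ring_AB"
    using ring_hom_ring.FactRing_iso_set[OF image_AB_hom] image_AB_surj[where 'a = 'a]
    by (simp add: kernel_image_AB ring_BC_def)
  moreover have "?h (image_BC Q) = image_AB Q" for Q :: "'a poly poly"
    using ring_hom_ring.the_elem_simp[OF image_AB_hom, of Q]
    by (simp add: kernel_image_AB image_BC_def)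
  ultimately show ?thesis
    by (intro bexI[of _ ?h] allI)
qed

section \<open>Regular functions\<close>

text \<open>The single fraction a/1 works on the whole spectrum, which is open as the set attached
  to the unit ideal: no prime ideal contains 1.\<close>

lemma regular_function_of_in_regular_functions:
  assumes "cring R" and a: "a \<in> carrier R"
  shows "regular_function_of R a \<in> regular_functions R"
proof -
  interpret cring R by fact
  have one: "\<one>\<^bsub>R\<^esub> \<notin> p" if "p \<in> prime_spectrum R" for p
  proof -
    from that interpret primeideal p R by (simp add: prime_spectrum_def)
    show ?thesis using I_notcarr one_imp_carrier by blast
  qed
  have "\<not> carrier R \<subseteq> p" if "p \<in> prime_spectrum R" for p
    using one[OF that] by auto
  then have "zariski_open R (prime_spectrum R)"
    unfolding zariski_open_def by (intro exI[of _ "carrier R"]) (auto intro: oneideal)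
  moreover have "regular_function_of R a p \<in> localization R p" if "p \<in> prime_spectrum R" for p
    using that one a by (auto simp: regular_function_of_def localization_def)
  moreover have "\<forall>p\<in>prime_spectrum R. \<one>\<^bsub>R\<^esub> \<notin> p \<and> regular_function_of R a p = loc_frac R p a \<one>\<^bsub>R\<^esub>"
    using one by (simp add: regular_function_of_def)
  moreover have "regular_function_of R a \<in> extensional (prime_spectrum R)"
    by (simp add: regular_function_of_def)
  ultimately show ?thesis
    using a unfolding regular_functions_def PiE_def by blast
qed

theorem theorem5p15:
  fixes P P' :: "'a::{finite,field} poly poly"
  assumes "optimal_determining P" and "optimal_determining P'"
  shows "[:Phi:] dvd (P - P')
    \<and> image_BC P = image_BC P'
    \<and> (\<exists>h \<in> ring_iso (ring_BC :: 'a poly poly set ring) ring_AB. \<forall>Q. h (image_BC Q) = image_AB Q)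
    \<and> image_AB P = image_AB P'
    \<and> (\<exists>!\<sigma>. \<sigma> \<in> regular_functions (ring_AB :: ('a poly set, nat \<Rightarrow> 'a poly set) up_ring)
          \<and> (\<forall>Q :: 'a poly poly. optimal_determining Q \<longrightarrow> \<sigma> = regular_function_of ring_AB (image_AB Q)))"
proof (intro conjI)
  show "[:Phi:] dvd (P - P')"
    using assms by (rule Phi_dvd_diff_of_optimal_determining)
  then show "image_BC P = image_BC P'" "image_AB P = image_AB P'"
    by (simp_all only: image_BC_eq_iff image_AB_eq_iff)
  show "\<exists>h \<in> ring_iso (ring_BC :: 'a poly poly set ring) ring_AB. \<forall>Q. h (image_BC Q) = image_AB Q"
    by (rule ring_BC_iso_ring_AB)
  have same: "image_AB P = image_AB Q" if "optimal_determining Q" for Q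
    using Phi_dvd_diff_of_optimal_determining[OF assms(1) that] by (simp only: image_AB_eq_iff)
  have "image_AB P \<in> carrier ring_AB"
    using image_AB_surj by auto
  then have regular: "regular_function_of ring_AB (image_AB P) \<in> regular_functions ring_AB"
    by (rule regular_function_of_in_regular_functions[OF cring_ring_AB])
  show "\<exists>!\<sigma>. \<sigma> \<in> regular_functions (ring_AB :: ('a poly set, nat \<Rightarrow> 'a poly set) up_ring)
          \<and> (\<forall>Q :: 'a poly poly. optimal_determining Q \<longrightarrow> \<sigma> = regular_function_of ring_AB (image_AB Q))"
  \<comment> \<open>Existence is the independence of the choice of \<open>Q\<close>; uniqueness is
    the instance \<open>Q = P\<close> of the condition on \<open>\<sigma>\<close>.\<close>
  proof (rule ex1I[of _ "regular_function_of ring_AB (image_AB P)"])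
    have "regular_function_of ring_AB (image_AB P) = regular_function_of ring_AB (image_AB Q)"
      if "optimal_determining Q" for Q
      by (simp only: same[OF that])
    then show "regular_function_of ring_AB (image_AB P) \<in> regular_functions ring_AB
        \<and> (\<forall>Q. optimal_determining Q
              \<longrightarrow> regular_function_of ring_AB (image_AB P) = regular_function_of ring_AB (image_AB Q))"
      using regular by blast
  next
    fix \<sigma>
    assume \<sigma>: "\<sigma> \<in> regular_functions (ring_AB :: ('a poly set, nat \<Rightarrow> 'a poly set) up_ring)
        \<and> (\<forall>Q :: 'a poly poly. optimal_determining Q \<longrightarrow> \<sigma> = regular_function_of ring_AB (image_AB Q))"
    show "\<sigma> = regular_function_of ring_AB (image_AB P)"
      by (rule \<sigma>[THEN conjunct2, rule_format, OF assms(1)])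
  qed
qed

end
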